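(* Let $\mathbf{j}\in\mathbb{N}^n$ be a multi-index and $\mathbf{a}=(a_1,\dots,a_n)^T\in\mathbb{R}^n$ with $\mathbf{a}^T(\mathbf{j}+\mathbf{1})=0$, and consider the elementary divergence-free vector field $$\dot x_i=a_i\,x_i\,\mathbf{x}^{\mathbf{j}},\qquad i=1,\dots,n. \qquad ( * )$$ Then the function $I_1=\mathbf{x}^{\mathbf{j}+\mathbf{1}}$ is an integral of $( * )$. Moreover, if $\mathbf{b}\in\mathbb{R}^n$ is any other vector orthogonal to $\mathbf{a}$, then $\mathbf{x}^{\mathbf{b}}$ is also an integral of $( * )$. In particular, it follows that $( * )$ has $n-1$ independent integrals of motion, hence the elementary divergence-free vector field $( * )$ is integrable.
   Context: Here $\mathbf{x}=(x_1,\dots,x_n)^T\in\mathbb{R}^n$, $\mathbb{N}$ includes $0$, and $\mathbf{1}=(1,\dots,1)^T$. For a vector of exponents $\mathbf{b}=(b_1,\dots,b_n)$, $\mathbf{x}^{\mathbf{b}}=x_1^{b_1}x_2^{b_2}\cdots x_n^{b_n}$; in particular $\mathbf{x}^{\mathbf{j}}=x_1^{j_1}\cdots x_n^{j_n}$. The algebraic relation $\mathbf{a}^T(\mathbf{j}+\mathbf{1})=0$ is the divergence-free condition for $( * )$; an "elementary divergence-free vector field" (associated to the monomial $\mathbf{x}^{\mathbf{j}}$) is a field of the form $( * )$ satisfying this condition. An integral (of motion) of a differential equation is a function that is constant along its solutions. Integrals $I_1,\dots,I_{n-1}$ are (functionally) independent if $c_1\nabla I_1+\cdots+c_{n-1}\nabla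 I_{n-1}=0$ has only the trivial solution $c_1=\cdots=c_{n-1}=0$. A system in $\mathbb{R}^n$ is called integrable here if it possesses $n-1$ independent integrals of motion. *)

theory Defs
  imports "HOL-Analysis.Analysis"
begin

definition monomial :: "nat ^ 'n \<Rightarrow> real ^ 'n \<Rightarrow> real" where
  "monomial j x = (\<Prod>i\<in>UNIV. (x $ i) ^ (j $ i))"

(* Real powers in their usual real domain: every base for exponents in \<nat>, every nonzero base
   for exponents in \<int>, positive bases otherwise. The integer case is separate because powr does
   not agree with powi at negative bases. *)
definition real_pow :: "real \<Rightarrow> real \<Rightarrow> real" where
  "real_pow x b = (if b \<in> \<int> then x powi \<lfloor>b\<rfloor> else x powr b)"

definition real_pow_defined :: "real \<Rightarrow> real \<Rightarrow> bool" where
  "real_pow_defined x b \<longleftrightarrow> b \<in> \<nat> \<or> (b \<in> \<int> \<and> x \<noteq> 0) \<or> x > 0"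

definition real_monomial :: "real ^ 'n \<Rightarrow> real ^ 'n \<Rightarrow> real" where
  "real_monomial b x = (\<Prod>i\<in>UNIV. real_pow (x $ i) (b $ i))"

definition real_monomial_domain :: "real ^ 'n \<Rightarrow> (real ^ 'n) set" where
  "real_monomial_domain b = {x. \<forall>i. real_pow_defined (x $ i) (b $ i)}"

definition positive_orthant :: "(real ^ 'n) set" where
  "positive_orthant = {x. \<forall>i. x $ i > 0}"

definition elementary_field :: "real ^ 'n \<Rightarrow> nat ^ 'n \<Rightarrow> real ^ 'n \<Rightarrow> real ^ 'n" where
  "elementary_field a j x = (\<chi> i. a $ i * x $ i * monomial j x)"

definition solution_on ::
    "(real ^ 'n \<Rightarrow> real ^ 'n) \<Rightarrow> real set \<Rightarrow> (real \<Rightarrow> real ^ 'n) \<Rightarrow> bool" where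
  "solution_on F T x \<longleftrightarrow>
     is_interval T \<and> (\<forall>t\<in>T. (x has_vector_derivative F (x t)) (at t within T))"

definition integral_of_motion ::
    "(real ^ 'n \<Rightarrow> real ^ 'n) \<Rightarrow> (real ^ 'n) set \<Rightarrow> (real ^ 'n \<Rightarrow> real) \<Rightarrow> bool" where
  "integral_of_motion F U I \<longleftrightarrow>
     (\<forall>T x. solution_on F T x \<longrightarrow> x ` T \<subseteq> U \<longrightarrow> (\<forall>s\<in>T. \<forall>t\<in>T. I (x s) = I (x t)))"

definition functionally_independent_at ::
    "nat \<Rightarrow> (nat \<Rightarrow> real ^ 'n \<Rightarrow> real) \<Rightarrow> real ^ 'n \<Rightarrow> bool" where
  "functionally_independent_at m I x \<longleftrightarrow>
     (\<exists>g. (\<forall>k<m. GDERIV (I k) x :> g k) \<and>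
          (\<forall>c. (\<Sum>k<m. c k *\<^sub>R g k) = 0 \<longrightarrow> (\<forall>k<m. c k = 0)))"

(* The integrals are global and continuously differentiable. Independence is only required on an
   open dense set: at every point of the space it would fail already for the planar saddle
   x' = x, y' = -y, where the gradient of any integral vanishes at the origin. *)
definition integrable_system :: "(real ^ 'n \<Rightarrow> real ^ 'n) \<Rightarrow> bool" where
  "integrable_system F \<longleftrightarrow>
     (\<exists>I. (\<forall>k < CARD('n) - 1. integral_of_motion F UNIV (I k) \<and>
             (\<exists>g. continuous_on UNIV g \<and> (\<forall>x. GDERIV (I k) x :> g x))) \<and>
          (\<exists>V. open V \<and> closure V = UNIV \<and>
             (\<forall>x\<in>V. functionally_independent_at (CARD('n) - 1) I x)))"

end

(* A product I x = (\<Prod>i. f i (x $ i)) whose factors satisfy Euler's relation y * f i' y = b i * f i y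
   has (x $ i) * (d I / d x $ i) = b i * I. Its derivative along the field is therefore
   (a \<bullet> b) * x^j * I, which vanishes for b orthogonal to a; this also holds where coordinates are zero.
   For the global integrals take f i y = \<bar>y\<bar> powr (b i) with b i > 2, which is continuously differentiable
   on the whole line. The orthogonal complement of a contains the positive vector j + 1, so it is
   spanned by vectors with all entries > 2. At points with nonzero coordinates the gradients of the
   resulting integrals are, up to nonzero factors, the vectors b k / x, hence independent. *)
theory Submission
  imports Defs
begin

section \<open>Products of one-variable functions as integrals of motion\<close>

lemma GDERIV_prod_coordinates:
  fixes x :: "real ^ 'n"
  assumes "\<And>i. (f i has_real_derivative f' i) (at (x $ i))"
  shows "GDERIV (\<lambda>x. \<Prod>i\<in>UNIV. f i (x $ i)) x :> (\<chi> i. f' i * (\<Prod>l\<in>UNIV-{i}. f l (x $ l)))"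
proof -
  have "((\<lambda>x. f i (x $ i)) has_derivative (\<lambda>h. f' i * h $ i)) (at x)" for i
  proof -
    have "((\<lambda>x::real^'n. x $ i) has_derivative (\<lambda>h. h $ i)) (at x)"
      by (rule bounded_linear_imp_has_derivative) (rule bounded_linear_vec_nth)
    from has_derivative_compose[OF this] assms[of i] show ?thesis
      by (simp add: has_field_derivative_def)
  qed
  then have "((\<lambda>x. \<Prod>i\<in>UNIV. f i (x $ i)) has_derivative
      (\<lambda>h. \<Sum>i\<in>UNIV. (f' i * h $ i) * (\<Prod>l\<in>UNIV-{i}. f l (x $ l)))) (at x)"
    by (intro has_derivative_prod) auto
  then show ?thesis
    by (simp add: gderiv_def inner_vec_def mult_ac)
qed

lemma Euler_relation_prod:
  fixes x :: "real ^ 'n"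
  assumes "x $ i * f' i = b $ i * f i (x $ i)"
  shows "x $ i * (f' i * (\<Prod>l\<in>UNIV-{i}. f l (x $ l))) = b $ i * (\<Prod>l\<in>UNIV. f l (x $ l))"
proof -
  have "(\<Prod>l\<in>UNIV. f l (x $ l)) = f i (x $ i) * (\<Prod>l\<in>UNIV-{i}. f l (x $ l))"
    by (rule prod.remove) auto
  then show ?thesis
    by (metis assms mult.assoc)
qed

text \<open>Differentiability and Euler's relation are asked for only on \<open>U\<close>, because
  powers with negative or non-integer exponents satisfy them on part of the line only.\<close>

lemma integral_of_motion_prod:
  fixes a b :: "real ^ 'n"
  assumes "orthogonal a b"
    and deriv: "\<And>x i. x \<in> U \<Longrightarrow> (f i has_real_derivative f' i (x $ i)) (at (x $ i))"
    and Euler: "\<And>x i. x \<in> U \<Longrightarrow> x $ i * f' i (x $ i) = b $ i * f i (x $ i)"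
  shows "integral_of_motion (elementary_field a j) U (\<lambda>x. \<Prod>i\<in>UNIV. f i (x $ i))"
  unfolding integral_of_motion_def
proof (intro allI impI ballI)
  fix T :: "real set" and x s t
  assume sol: "solution_on (elementary_field a j) T x" and U: "x ` T \<subseteq> U" and st: "s \<in> T" "t \<in> T"
  let ?I = "\<lambda>x. \<Prod>i\<in>UNIV. f i (x $ i)"
  have "((\<lambda>t. ?I (x t)) has_derivative (\<lambda>h. 0)) (at t within T)" if t: "t \<in> T" for t
  proof -
    let ?g = "\<chi> i. f' i (x t $ i) * (\<Prod>l\<in>UNIV-{i}. f l (x t $ l))"
    have xt: "x t \<in> U" using U t by auto
    have "GDERIV ?I (x t) :> ?g"
      using deriv[OF xt] by (rule GDERIV_prod_coordinates)
    then have "(?I has_derivative (\<lambda>h. h \<bullet> ?g)) (at (x t))"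
      by (simp add: gderiv_def)
    moreover have "(x has_derivative (\<lambda>h. h *\<^sub>R elementary_field a j (x t))) (at t within T)"
      using sol t by (simp add: solution_on_def has_vector_derivative_def)
    ultimately have "((\<lambda>t. ?I (x t)) has_derivative
        (\<lambda>h. (h *\<^sub>R elementary_field a j (x t)) \<bullet> ?g)) (at t within T)"
      by (rule has_derivative_compose[rotated])
    moreover have "elementary_field a j (x t) \<bullet> ?g = 0"
    proof -
      have "elementary_field a j (x t) $ i * ?g $ i = (monomial j (x t) * ?I (x t)) * (a $ i * b $ i)"
        for i
      proof -
        have "elementary_field a j (x t) $ i * ?g $ i = a $ i * monomial j (x t) * (x t $ i * ?g $ i)"
          by (simp add: elementary_field_def)
        also have "x t $ i * ?g $ i = b $ i * ?I (x t)"
          using Euler_relation_prod[of "x t" i "\<lambda>i. f' i (x t $ i)" b f, OF Euler[OF xt]] by simp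
        finally show ?thesis by (simp only: mult_ac)
      qed
      then have "elementary_field a j (x t) \<bullet> ?g = (monomial j (x t) * ?I (x t)) * (a \<bullet> b)"
        unfolding inner_vec_def by (simp add: sum_distrib_left)
      then show ?thesis
        using \<open>orthogonal a b\<close> by (simp add: orthogonal_def)
    qed
    ultimately show ?thesis by simp
  qed
  \<comment> \<open>Solutions live on intervals, and on a convex set a vanishing derivative forces a
    single constant value.\<close>
  moreover have "convex T"
    using sol by (simp add: solution_on_def is_interval_convex)
  ultimately obtain c where "\<And>t. t \<in> T \<Longrightarrow> ?I (x t) = c"
    using has_derivative_zero_constant[of T "\<lambda>t. ?I (x t)"] by blast
  then show "?I (x s) = ?I (x t)" using st by simp
qed

text \<open>Natural powers satisfy Euler's relation on the whole line, hence the domain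
  \<open>UNIV\<close>. For \<open>e = j + 1\<close> the orthogonality is the divergence-free
  condition.\<close>

lemma monomial_integral_of_motion:
  fixes a :: "real ^ 'n" and e :: "nat ^ 'n"
  assumes "orthogonal a (\<chi> i. real (e $ i))"
  shows "integral_of_motion (elementary_field a j) UNIV (monomial e)"
proof -
  have "integral_of_motion (elementary_field a j) UNIV (\<lambda>x. \<Prod>i\<in>UNIV. (x $ i) ^ (e $ i))"
    using assms
  proof (rule integral_of_motion_prod[where f = "\<lambda>i y. y ^ (e $ i)"
        and f' = "\<lambda>i y. real (e $ i) * y ^ (e $ i - 1)"])
    show "((\<lambda>y. y ^ (e $ i)) has_real_derivative real (e $ i) * (x $ i) ^ (e $ i - 1)) (at (x $ i))"
      for x :: "real ^ 'n" and i
      using DERIV_pow[of "e $ i" "x $ i"] by simp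
    show "x $ i * (real (e $ i) * (x $ i) ^ (e $ i - 1)) = (\<chi> i. real (e $ i)) $ i * (x $ i) ^ (e $ i)"
      for x :: "real ^ 'n" and i
      \<comment> \<open>For \<open>e $ i = 0\<close> the subtraction in the exponent is truncated,
        but the factor \<open>real (e $ i)\<close> vanishes.\<close>
      by (cases "e $ i") auto
  qed
  then show ?thesis
    by (simp add: monomial_def[abs_def])
qed

section \<open>Monomials with real exponents\<close>

lemma real_pow_of_nat [simp]: "real_pow x (real n) = x ^ n"
  by (simp add: real_pow_def)

lemma real_pow_eq_powr: "x > 0 \<Longrightarrow> real_pow x b = x powr b"
  by (auto simp: real_pow_def powr_real_of_int' elim!: Ints_cases)

text \<open>Each kind of exponent has its own derivative rule, valid exactly under the matching
  clause of \<open>real_pow_defined\<close>. The derivative is left abstract, since later only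
  Euler's relation matters. Natural exponents come first, as they alone allow the base 0.\<close>

lemma real_pow_Euler_relation:
  assumes "real_pow_defined x b"
  obtains d where "((\<lambda>y. real_pow y b) has_real_derivative d) (at x)" "x * d = b * real_pow x b"
proof (cases "b \<in> \<nat>")
  case True
  then obtain n where b: "b = real n" by (auto elim: Nats_cases)
  have "((\<lambda>y. real_pow y b) has_real_derivative real n * x ^ (n - 1)) (at x)"
    using DERIV_pow[of n x] by (simp add: b)
  moreover have "x * (real n * x ^ (n - 1)) = b * real_pow x b"
    by (cases n) (auto simp: b simp flip: of_nat_Suc)
  ultimately show thesis by (rule that)
next
  case nat: False
  show thesis
  proof (cases "b \<in> \<int>")
    case True
    then obtain k where b: "b = of_int k" by (auto elim: Ints_cases)
    have "x \<noteq> 0" using assms nat by (auto simp: real_pow_defined_def)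
    have "((\<lambda>y. real_pow y b) has_real_derivative of_int k * x powi (k - 1)) (at x)"
      using DERIV_power_int[OF DERIV_ident, of k x UNIV] \<open>x \<noteq> 0\<close> by (simp add: b real_pow_def)
    moreover have "x * (of_int k * x powi (k - 1)) = b * real_pow x b"
      using \<open>x \<noteq> 0\<close> by (simp add: b real_pow_def power_int_diff)
    ultimately show thesis by (rule that)
  next
    case False
    then have "x > 0" using assms nat by (auto simp: real_pow_defined_def)
    have "((\<lambda>y. real_pow y b) has_real_derivative b * x powr (b - 1)) (at x)"
      using has_real_derivative_powr[OF \<open>x > 0\<close>, of b] False by (simp add: real_pow_def)
    moreover have "x * (b * x powr (b - 1)) = b * real_pow x b"
      using \<open>x > 0\<close> False by (simp add: real_pow_def powr_diff)
    ultimately show thesis by (rule that)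
  qed
qed

lemma real_monomial_integral_of_motion:
  assumes "orthogonal a b"
  shows "integral_of_motion (elementary_field a j) (real_monomial_domain b) (real_monomial b)"
proof -
  \<comment> \<open>The implication stands inside the existential, so that choice yields one
    derivative function \<open>d i\<close> on the whole line.\<close>
  have "\<forall>i y. \<exists>d. real_pow_defined y (b $ i) \<longrightarrow>
      ((\<lambda>y. real_pow y (b $ i)) has_real_derivative d) (at y) \<and> y * d = b $ i * real_pow y (b $ i)"
    using real_pow_Euler_relation by blast
  then obtain d where "\<And>i y. real_pow_defined y (b $ i) \<Longrightarrow>
      ((\<lambda>y. real_pow y (b $ i)) has_real_derivative d i y) (at y) \<and>
      y * d i y = b $ i * real_pow y (b $ i)"
    by metis
  then have "integral_of_motion (elementary_field a j) (real_monomial_domain b)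
      (\<lambda>x. \<Prod>i\<in>UNIV. real_pow (x $ i) (b $ i))"
    using assms
    by (intro integral_of_motion_prod[where f = "\<lambda>i y. real_pow y (b $ i)" and f' = d])
      (auto simp: real_monomial_domain_def)
  then show ?thesis
    by (simp add: real_monomial_def[abs_def])
qed

lemma integral_of_motion_subset:
  "integral_of_motion F U I \<Longrightarrow> V \<subseteq> U \<Longrightarrow> integral_of_motion F V I"
  unfolding integral_of_motion_def by (meson subset_trans)

section \<open>Powers of the absolute value\<close>

text \<open>The critical point is \<open>y = 0\<close>, where a positive exponent makes the power
  tend to 0, its value there.\<close>

lemma isCont_abs_powr:
  fixes y c :: real
  assumes "c > 0"
  shows "isCont (\<lambda>y. \<bar>y\<bar> powr c) y"
  unfolding isCont_def using assms by (intro tendsto_powr' tendsto_intros) auto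

text \<open>The factor \<open>y\<close> carries the sign, so one formula covers the whole line;
  since \<open>b - 2\<close> is positive, it is continuous even at 0.\<close>

lemma has_real_derivative_abs_powr:
  fixes b y :: real
  assumes "b > 2"
  shows "((\<lambda>y. \<bar>y\<bar> powr b) has_real_derivative b * (y * \<bar>y\<bar> powr (b - 2))) (at y)"
proof (cases "y = 0")
  case True
  have "isCont (\<lambda>y. y * \<bar>y\<bar> powr (b - 2)) 0"
    using assms by (intro isCont_mult continuous_ident isCont_abs_powr) auto
  then have "(\<lambda>y. y * \<bar>y\<bar> powr (b - 2)) \<midarrow>0\<rightarrow> 0"
    by (simp add: isCont_def)
  \<comment> \<open>This is the difference quotient at 0.\<close>
  moreover have "\<bar>y\<bar> powr b / y = y * \<bar>y\<bar> powr (b - 2)" if "y \<noteq> 0" for y :: real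
    using that by (simp add: powr_diff divide_simps power2_eq_square flip: abs_mult)
  ultimately have "(\<lambda>y. \<bar>y\<bar> powr b / y) \<midarrow>0\<rightarrow> 0"
    by (simp cong: LIM_cong)
  then show ?thesis
    by (simp add: True has_field_derivative_iff)
next
  case False
  have "((\<lambda>y. \<bar>y\<bar> powr b) has_real_derivative b * \<bar>y\<bar> powr (b - 1) * sgn y) (at y)"
  proof -
    have "(abs has_real_derivative sgn y) (at y)"
      using has_derivative_norm[OF False] by (simp add: has_field_derivative_def real_norm_def[abs_def] mult_commute_abs)
    then show ?thesis
      using False by (auto intro!: derivative_eq_intros)
  qed
  moreover have "b * \<bar>y\<bar> powr (b - 1) * sgn y = b * (y * \<bar>y\<bar> powr (b - 2))"
    using False by (simp add: powr_diff divide_simps power2_eq_square sgn_if)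
  ultimately show ?thesis by simp
qed

section \<open>Independent gradients, orthogonal exponents and density\<close>

text \<open>Multiplying coordinate \<open>i\<close> of a vanishing combination of gradients by
  \<open>x $ i\<close> turns it into a combination of the \<open>b k\<close> with coefficients
  \<open>c k * I k x\<close>. These vanish by independence, and \<open>I k x\<close> can be
  cancelled.\<close>

lemma functionally_independent_at_if_Euler_relation:
  fixes b :: "nat \<Rightarrow> real ^ 'n"
  assumes indep: "independent (b ` {..<m})" "inj_on b {..<m}"
    and grad: "\<And>k. k < m \<Longrightarrow> GDERIV (I k) x :> g k"
    and Euler: "\<And>k i. k < m \<Longrightarrow> x $ i * g k $ i = b k $ i * I k x"
    and nz: "\<And>k. k < m \<Longrightarrow> I k x \<noteq> 0"
  shows "functionally_independent_at m I x"
  unfolding functionally_independent_at_def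
proof (intro exI conjI allI impI)
  fix k assume "k < m" then show "GDERIV (I k) x :> g k" by (rule grad)
next
  fix c k
  assume c: "(\<Sum>k<m. c k *\<^sub>R g k) = 0" and k: "k < m"
  have "(\<Sum>k<m. (c k * I k x) *\<^sub>R b k) $ i = 0" for i
  proof -
    have "(\<Sum>k<m. (c k * I k x) *\<^sub>R b k) $ i = (\<Sum>k<m. x $ i * (c k * g k $ i))"
      unfolding sum_component
    proof (rule sum.cong)
      fix k assume "k \<in> {..<m}"
      then show "((c k * I k x) *\<^sub>R b k) $ i = x $ i * (c k * g k $ i)"
        using Euler[of k i] by (simp add: mult.left_commute[of "x $ i"] mult_ac(1,2))
    qed simp
    also have "\<dots> = x $ i * (\<Sum>k<m. c k *\<^sub>R g k) $ i"
      by (simp add: sum_component sum_distrib_left)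
    finally show ?thesis by (simp add: c)
  qed
  then have "(\<Sum>k<m. (c k * I k x) *\<^sub>R b k) = 0"
    by (simp add: vec_eq_iff)
  \<comment> \<open>Linear independence is a property of sets, so the indexed sum is rewritten over
    the image of \<open>b\<close>; injectivity recovers each index.\<close>
  then have "(\<Sum>v\<in>b ` {..<m}. (c (the_inv_into {..<m} b v) * I (the_inv_into {..<m} b v) x) *\<^sub>R v) = 0"
    using indep(2) by (simp add: sum.reindex the_inv_into_f_f)
  then have "c (the_inv_into {..<m} b (b k)) * I (the_inv_into {..<m} b (b k)) x = 0"
    using indep(1) k by (intro independentD[of "b ` {..<m}" "b ` {..<m}"]) auto
  then show "c k = 0"
    using k nz[OF k] indep(2) by (simp add: the_inv_into_f_f)
qed

text \<open>Any \<open>w\<close> orthogonal to \<open>a\<close> is the difference of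
  \<open>w + M *\<^sub>R p\<close> and \<open>M *\<^sub>R p\<close>, and for large \<open>M\<close>
  both have all entries above 2. Such vectors therefore span the hyperplane, and a basis can be
  chosen among them.\<close>

lemma ex_orthogonal_large_family:
  fixes a p :: "real ^ 'n"
  assumes "orthogonal a p" and p: "\<And>i. p $ i > 0"
  obtains b :: "nat \<Rightarrow> real ^ 'n"
  where "inj_on b {..<CARD('n) - 1}" "independent (b ` {..<CARD('n) - 1})"
    "\<And>k. k < CARD('n) - 1 \<Longrightarrow> orthogonal a (b k)"
    "\<And>k i. k < CARD('n) - 1 \<Longrightarrow> b k $ i > 2"
proof -
  let ?H = "{v. a \<bullet> v = 0}" and ?S = "{v. a \<bullet> v = 0 \<and> (\<forall>i. v $ i > 2)}"
  have "?H \<subseteq> span ?S"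
  proof
    fix w assume w: "w \<in> ?H"
    have "\<forall>\<^sub>F M in at_top. w $ i + M * p $ i > 2 \<and> M * p $ i > 2" for i
    proof -
      have "filterlim (\<lambda>M. M * p $ i) at_top at_top"
        using p[of i] by (intro filterlim_at_top_mult_tendsto_pos[OF tendsto_const]) (auto simp: filterlim_ident)
      then have "\<forall>\<^sub>F M in at_top. M * p $ i > max 2 (2 - w $ i)"
        unfolding filterlim_at_top_dense by (rule spec)
      then show ?thesis
        by eventually_elim auto
    qed
    \<comment> \<open>There are finitely many coordinates, so one \<open>M\<close> serves them
      all.\<close>
    then have "\<forall>\<^sub>F M in at_top. \<forall>i. w $ i + M * p $ i > 2 \<and> M * p $ i > 2"
      by (rule eventually_all_finite)
    then obtain M where M: "\<And>i. w $ i + M * p $ i > 2" "\<And>i. M * p $ i > 2"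
      by (metis (mono_tags, lifting) eventually_happens' trivial_limit_at_top_linorder)
    then have "w + M *\<^sub>R p \<in> ?S" "M *\<^sub>R p \<in> ?S"
      using w assms(1) by (auto simp: orthogonal_def inner_add_right)
    then have "(w + M *\<^sub>R p) - M *\<^sub>R p \<in> span ?S"
      by (intro span_diff span_base)
    then show "w \<in> span ?S" by simp
  qed
  then have "dim ?H \<le> dim ?S"
    by (rule dim_mono)
  \<comment> \<open>Only an inequality holds in general: for \<open>a = 0\<close> the set
    \<open>?H\<close> is the whole space. This is also why a subset \<open>C\<close> of the basis is
    selected below.\<close>
  moreover have "dim ?H \<ge> CARD('n) - 1"
    by (cases "a = 0") (auto simp: dim_hyperplane)
  ultimately have dim: "CARD('n) - 1 \<le> dim ?S" by simp
  obtain B where B: "B \<subseteq> ?S" "independent B" "?S \<subseteq> span B" "card B = dim ?S"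
    by (rule basis_exists)
  obtain C where C: "C \<subseteq> B" "card C = CARD('n) - 1" "finite C"
    using dim unfolding B(4)[symmetric] by (rule obtain_subset_with_card_n)
  obtain b where b: "bij_betw b {..<CARD('n) - 1} C"
    using ex_bij_betw_nat_finite[OF C(3)] C(2) by (auto simp: atLeast0LessThan)
  show thesis
  proof
    show "inj_on b {..<CARD('n) - 1}" using b by (rule bij_betw_imp_inj_on)
    show "independent (b ` {..<CARD('n) - 1})"
      using b C(1) B(2) by (metis bij_betw_imp_surj_on independent_mono)
  qed (use bij_betw_apply[OF b] B C in \<open>auto simp: orthogonal_def\<close>)
qed

text \<open>Replacing the zero coordinates of \<open>x\<close> by \<open>1 / (n + 1)\<close> gives a
  sequence in the set that converges to \<open>x\<close>.\<close>

lemma closure_nonzero_coordinates: "closure {x :: real ^ 'n. \<forall>i. x $ i \<noteq> 0} = UNIV"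
proof -
  have "x \<in> closure {x. \<forall>i. x $ i \<noteq> 0}" for x :: "real ^ 'n"
  proof -
    define y where "y n = (\<chi> i. if x $ i = 0 then inverse (real (Suc n)) else x $ i)" for n
    have "y \<longlonglongrightarrow> x"
    proof (rule vec_tendstoI)
      show "(\<lambda>n. y n $ i) \<longlonglongrightarrow> x $ i" for i
        using LIMSEQ_inverse_real_of_nat by (cases "x $ i = 0") (auto simp: y_def)
    qed
    moreover have "\<forall>n. y n \<in> {x. \<forall>i. x $ i \<noteq> 0}"
      by (auto simp: y_def)
    ultimately show ?thesis
      unfolding closure_sequential by blast
  qed
  then show ?thesis by auto
qed

section \<open>Global integrals and integrability of the field\<close>

theorem theorem1:
  fixes j :: "nat ^ 'n" and a :: "real ^ 'n"
  assumes "a \<bullet> (\<chi> i. real ((j + 1) $ i)) = 0"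
  shows "integral_of_motion (elementary_field a j) UNIV (monomial (j + 1)) \<and>
    (\<forall>b :: real ^ 'n. orthogonal a b \<longrightarrow>
       integral_of_motion (elementary_field a j) (real_monomial_domain b) (real_monomial b)) \<and>
    (\<exists>b :: nat \<Rightarrow> real ^ 'n.
       (\<forall>k < CARD('n) - 1. orthogonal a (b k) \<and>
          integral_of_motion (elementary_field a j) positive_orthant (real_monomial (b k))) \<and>
       (\<forall>x\<in>positive_orthant.
          functionally_independent_at (CARD('n) - 1) (\<lambda>k. real_monomial (b k)) x)) \<and>
    integrable_system (elementary_field a j)"
proof -
  let ?m = "CARD('n) - 1" and ?F = "elementary_field a j" and ?p = "\<chi> i. real ((j + 1) $ i)"
  have p: "orthogonal a ?p"
    using assms by (simp add: orthogonal_def)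
  have "?p $ i > 0" for i by simp
  from ex_orthogonal_large_family[OF p this]
  obtain b :: "nat \<Rightarrow> real ^ 'n" where inj: "inj_on b {..<?m}"
    and indep: "independent (b ` {..<?m})"
    and orth: "\<And>k. k < ?m \<Longrightarrow> orthogonal a (b k)"
    and gt2: "\<And>k i. k < ?m \<Longrightarrow> b k $ i > 2"
    by metis
  \<comment> \<open>The absolute value extends the monomials with exponents \<open>b k\<close> from
    the positive orthant to the whole space, so one family of exponents serves both the real
    monomials and the global integrals.\<close>
  define f where "f k i y = \<bar>y\<bar> powr (b k $ i)" for k i and y :: real
  define f' where "f' k i y = b k $ i * (y * \<bar>y\<bar> powr (b k $ i - 2))" for k i and y :: real
  define I where "I k x = (\<Prod>i\<in>UNIV. f k i (x $ i))" for k and x :: "real ^ 'n"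
  define g where "g k x = (\<chi> i. f' k i (x $ i) * (\<Prod>l\<in>UNIV-{i}. f k l (x $ l)))" for k and x :: "real ^ 'n"
  have f': "(f k i has_real_derivative f' k i y) (at y)" if "k < ?m" for k i y
    using has_real_derivative_abs_powr[OF gt2[OF that]] by (simp add: f_def[abs_def] f'_def)
  \<comment> \<open>At \<open>y = 0\<close> both sides are 0.\<close>
  have Euler: "y * f' k i y = b k $ i * f k i y" for k i y
    by (simp add: f_def f'_def powr_diff power2_eq_square)
  have grad: "GDERIV (I k) x :> g k x" if "k < ?m" for k x
    unfolding I_def[abs_def] g_def
    by (rule GDERIV_prod_coordinates[where f = "f k"]) (rule f'[OF that])
  have Euler_I: "x $ i * g k x $ i = b k $ i * I k x" for x k i
    unfolding I_def g_def
    using Euler_relation_prod[where f = "f k" and f' = "\<lambda>i. f' k i (x $ i)", OF Euler] by simp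
  have nz: "I k x \<noteq> 0" if "\<And>i. x $ i \<noteq> 0" for k x
    using that by (simp add: I_def f_def)
  have cont: "continuous_on UNIV (g k)" if "k < ?m" for k
  proof -
    have "isCont (f k i) y" and "isCont (f' k i) y" for i y
      using gt2[OF that, of i]
      by (auto simp: f_def[abs_def] f'_def[abs_def] intro!: continuous_intros isCont_abs_powr)
    then have "isCont (\<lambda>x :: real ^ 'n. f k i (x $ i)) x" and "isCont (\<lambda>x :: real ^ 'n. f' k i (x $ i)) x" for i x
      by (auto intro: isCont_o2[OF continuous_component[OF continuous_ident]])
    then have "continuous_on UNIV (\<lambda>x :: real ^ 'n. f k i (x $ i))"
        "continuous_on UNIV (\<lambda>x :: real ^ 'n. f' k i (x $ i))" for i
      by (simp_all add: continuous_at_imp_continuous_on)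
    then show ?thesis
      unfolding g_def[abs_def] by (intro continuous_intros)
  qed
  have integral: "integral_of_motion ?F UNIV (I k)" if "k < ?m" for k
    unfolding I_def[abs_def]
    using orth[OF that] f'[OF that] Euler by (rule integral_of_motion_prod[where f = "f k"])
  have "integrable_system ?F"
    unfolding integrable_system_def
  proof (intro exI[of _ I] conjI allI impI exI[of _ "{x. \<forall>i. x $ i \<noteq> 0}"] ballI)
    show "open {x :: real ^ 'n. \<forall>i. x $ i \<noteq> 0}"
      by (simp add: Collect_all_eq open_INT open_Collect_neq continuous_intros)
    show "functionally_independent_at ?m I x" if "x \<in> {x. \<forall>i. x $ i \<noteq> 0}" for x
      using that by (intro functionally_independent_at_if_Euler_relation[OF indep inj grad Euler_I nz]) auto
    show "\<exists>g. continuous_on UNIV g \<and> (\<forall>x. GDERIV (I k) x :> g x)" if "k < ?m" for k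
      using grad[OF that] cont[OF that] by blast
  qed (use integral closure_nonzero_coordinates in auto)
  moreover have "functionally_independent_at ?m (\<lambda>k. real_monomial (b k)) x"
    if x: "x \<in> positive_orthant" for x
  proof -
    have open_pos: "open (positive_orthant :: (real ^ 'n) set)"
      unfolding positive_orthant_def
      by (simp add: Collect_all_eq open_INT open_Collect_less continuous_intros)
    have eq: "I k y = real_monomial (b k) y" if "y \<in> positive_orthant" for k y
      using that
      by (auto simp: I_def f_def real_monomial_def positive_orthant_def real_pow_eq_powr abs_of_pos)
    \<comment> \<open>The real monomial coincides with \<open>I k\<close> on the open positive
      orthant, so the two have the same gradient there.\<close>
    have "GDERIV (real_monomial (b k)) x :> g k x" if "k < ?m" for k
      using grad[OF that, of x] unfolding gderiv_def
      by (rule has_derivative_transform_within_open[OF _ open_pos x]) (rule eq)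
    moreover have "x $ i \<noteq> 0" for i
      using x by (auto simp: positive_orthant_def dest: spec[of _ i])
    ultimately show ?thesis
      using Euler_I[of x] nz[of x]
      by (intro functionally_independent_at_if_Euler_relation[OF indep inj]) (auto simp: eq[OF x])
  qed
  \<comment> \<open>At positive bases every real power is defined, so the orthant lies in each
    monomial's domain.\<close>
  moreover have "integral_of_motion ?F positive_orthant (real_monomial (b k))" if "k < ?m" for k
    using real_monomial_integral_of_motion[OF orth[OF that]]
    by (rule integral_of_motion_subset)
      (auto simp: positive_orthant_def real_monomial_domain_def real_pow_defined_def)
  ultimately show ?thesis
    using monomial_integral_of_motion[OF p] real_monomial_integral_of_motion orth by blast
qed

end
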